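(* Let $m \geq 2$ be an integer and let $G = SD_{8m} = \langle a, b : a^{4m} = b^2 = 1,\ bab = a^{2m-1} \rangle$ be the semidihedral group of order $8m$. Then $$M_1(\mathcal{CCC}(G)) = \begin{cases} (2m-1)(2m-2)^2, & \text{when } m \text{ is even} \\ (2m-2)(2m-3)^2 + 36, & \text{when } m \text{ is odd} \end{cases}$$ and $$M_2(\mathcal{CCC}(G)) = \begin{cases} \frac{(2m-1)(2m-2)^3}{2}, & \text{when } m \text{ is even} \\ (m-1)(2m-3)^3 + 54, & \text{when } m \text{ is odd.} \end{cases}$$ Further, $\frac{M_2(\mathcal{CCC}(G))}{|e(\mathcal{CCC}(G))|} \geq \frac{M_1(\mathcal{CCC}(G))}{|v(\mathcal{CCC}(G))|}$, with equality when $m = 3$.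
   Context: For a finite group $G$ and $x \in G$, $x^G$ denotes the conjugacy class of $x$ in $G$. The commuting conjugacy class graph $\mathcal{CCC}(G)$ is the simple undirected graph whose vertices are the conjugacy classes of non-central elements of $G$, where two distinct vertices $x^G$ and $y^G$ are adjacent if and only if there exist $x' \in x^G$ and $y' \in y^G$ with $x'y' = y'x'$. For a finite simple graph $\Gamma$ with vertex set $v(\Gamma)$ and edge set $e(\Gamma)$, the first and second Zagreb indices are $M_1(\Gamma) = \sum_{v \in v(\Gamma)} \deg(v)^2$ and $M_2(\Gamma) = \sum_{uv \in e(\Gamma)} \deg(u)\deg(v)$. *)

theory Defs
  imports Complex_Main "HOL-Algebra.Group"
begin

section \<open>Groups given by generators and relations\<close>

text \<open>
  A letter is a generator (tagged \<^term>\<open>True\<close>) or its formal inverse (tagged \<^term>\<open>False\<close>).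
  All elements of the type of generators are generators, and a pair \<open>(l, r)\<close> in the set of
  relations stands for the defining relation \<open>l = r\<close>.
\<close>

type_synonym 'g word = "('g \<times> bool) list"

inductive word_eq :: "('g word \<times> 'g word) set \<Rightarrow> 'g word \<Rightarrow> 'g word \<Rightarrow> bool"
  for R :: "('g word \<times> 'g word) set" where
  word_eq_refl: "word_eq R u u"
| word_eq_sym: "word_eq R u v \<Longrightarrow> word_eq R v u"
| word_eq_trans: "word_eq R u v \<Longrightarrow> word_eq R v w \<Longrightarrow> word_eq R u w"
| word_eq_cancel: "word_eq R (u @ [(x, e), (x, \<not> e)] @ v) (u @ v)"
| word_eq_relation: "(l, r) \<in> R \<Longrightarrow> word_eq R (u @ l @ v) (u @ r @ v)"

definition word_rel :: "('g word \<times> 'g word) set \<Rightarrow> ('g word \<times> 'g word) set" where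
  "word_rel R = {(u, v). word_eq R u v}"

definition presented_group :: "('g word \<times> 'g word) set \<Rightarrow> 'g word set monoid" where
  "presented_group R =
     \<lparr>carrier = UNIV // word_rel R,
      mult = (\<lambda>X Y. \<Union>u\<in>X. \<Union>v\<in>Y. word_rel R `` {u @ v}),
      one = word_rel R `` {[]}\<rparr>"

lemma equiv_word_rel: "equiv UNIV (word_rel R)"
  unfolding word_rel_def
  by (intro equivI refl_onI symI transI)
     (auto intro: word_eq_refl word_eq_sym word_eq_trans)

lemma word_class_eq_iff: "word_rel R `` {u} = word_rel R `` {v} \<longleftrightarrow> word_eq R u v"
  using eq_equiv_class_iff[OF equiv_word_rel, of u v R] by (simp add: word_rel_def)

lemma word_eq_context: "word_eq R u v \<Longrightarrow> word_eq R (p @ u @ q) (p @ v @ q)"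
proof (induction rule: word_eq.induct)
  case (word_eq_refl u)
  show ?case by (rule word_eq.word_eq_refl)
next
  case (word_eq_sym u v)
  then show ?case by (blast intro: word_eq.word_eq_sym)
next
  case (word_eq_trans u v w)
  then show ?case by (blast intro: word_eq.word_eq_trans)
next
  case (word_eq_cancel u x e v)
  show ?case using word_eq.word_eq_cancel[of R "p @ u" x e "v @ q"] by simp
next
  case (word_eq_relation l r u v)
  then show ?case using word_eq.word_eq_relation[of l r R "p @ u" "v @ q"] by simp
qed

lemma word_eq_append:
  assumes "word_eq R u u'" "word_eq R v v'"
  shows "word_eq R (u @ v) (u' @ v')"
  using word_eq_context[OF assms(1), of "[]" v] word_eq_context[OF assms(2), of u' "[]"]
  by (auto intro: word_eq_trans)

lemma presented_group_mult:
  "(word_rel R `` {u}) \<otimes>\<^bsub>presented_group R\<^esub> (word_rel R `` {v}) = word_rel R `` {u @ v}"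
proof -
  have "congruent2 (word_rel R) (word_rel R) (\<lambda>u v. word_rel R `` {u @ v})"
  proof (rule congruent2I')
    fix u u' v v' assume "(u, u') \<in> word_rel R" "(v, v') \<in> word_rel R"
    then have "word_eq R (u @ v) (u' @ v')" by (auto simp: word_rel_def intro: word_eq_append)
    then show "word_rel R `` {u @ v} = word_rel R `` {u' @ v'}" by (simp only: word_class_eq_iff)
  qed
  from UN_equiv_class2[OF equiv_word_rel equiv_word_rel this] show ?thesis
    by (simp add: presented_group_def)
qed

lemma word_eq_inverse: "word_eq R (rev (map (map_prod id Not) u) @ u) []"
proof (induction u)
  case Nil
  show ?case by (simp add: word_eq_refl)
next
  case (Cons y u)
  obtain x e where [simp]: "y = (x, e)" by force
  have "word_eq R (rev (map (map_prod id Not) (y # u)) @ (y # u))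
                  (rev (map (map_prod id Not) u) @ u)"
    using word_eq_cancel[of R "rev (map (map_prod id Not) u)" x "\<not> e" u] by simp
  then show ?case using Cons.IH by (rule word_eq_trans)
qed

lemma group_presented_group: "group (presented_group R)"
proof (rule groupI)
  fix X assume "X \<in> carrier (presented_group R)"
  then obtain u where X: "X = word_rel R `` {u}"
    by (auto simp: presented_group_def elim: quotientE)
  have "word_rel R `` {rev (map (map_prod id Not) u)} \<otimes>\<^bsub>presented_group R\<^esub> X
          = \<one>\<^bsub>presented_group R\<^esub>"
    unfolding X presented_group_mult using word_eq_inverse[of R u]
    by (simp add: presented_group_def word_class_eq_iff)
  then show "\<exists>Y\<in>carrier (presented_group R).
      Y \<otimes>\<^bsub>presented_group R\<^esub> X = \<one>\<^bsub>presented_group R\<^esub>"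
    by (rule bexI) (simp add: presented_group_def quotientI)
  show "\<one>\<^bsub>presented_group R\<^esub> \<otimes>\<^bsub>presented_group R\<^esub> X = X"
    using presented_group_mult[of R "[]" u] by (simp add: X presented_group_def)
next
  fix X Y Z
  assume "X \<in> carrier (presented_group R)" "Y \<in> carrier (presented_group R)"
    "Z \<in> carrier (presented_group R)"
  then obtain u v w where "X = word_rel R `` {u}" "Y = word_rel R `` {v}" "Z = word_rel R `` {w}"
    by (auto simp: presented_group_def elim!: quotientE)
  then show "X \<otimes>\<^bsub>presented_group R\<^esub> Y \<otimes>\<^bsub>presented_group R\<^esub> Z =
      X \<otimes>\<^bsub>presented_group R\<^esub> (Y \<otimes>\<^bsub>presented_group R\<^esub> Z)"
    by (simp add: presented_group_mult)
next
  fix X Y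
  assume "X \<in> carrier (presented_group R)" "Y \<in> carrier (presented_group R)"
  then obtain u v where "X = word_rel R `` {u}" "Y = word_rel R `` {v}"
    by (auto simp: presented_group_def elim!: quotientE)
  then have "X \<otimes>\<^bsub>presented_group R\<^esub> Y = word_rel R `` {u @ v}"
    by (simp add: presented_group_mult)
  then show "X \<otimes>\<^bsub>presented_group R\<^esub> Y \<in> carrier (presented_group R)"
    by (simp add: presented_group_def quotientI)
qed (simp add: presented_group_def quotientI)

datatype sd_gen = Gen_a | Gen_b

definition semidihedral_group :: "nat \<Rightarrow> sd_gen word set monoid" where
  "semidihedral_group m =
     (let a = (Gen_a, True); b = (Gen_b, True) in
      presented_group
        {(replicate (4 * m) a, []),
         (replicate 2 b, []),
         ([b, a, b], replicate (2 * m - 1) a)})"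

section \<open>Finite simple graphs and Zagreb indices\<close>

text \<open>Edges are two-element sets of vertices.\<close>

record 'v ugraph =
  vertices :: "'v set"
  edges :: "'v set set"

definition degree :: "'v ugraph \<Rightarrow> 'v \<Rightarrow> nat" where
  "degree \<Gamma> v = card {e \<in> edges \<Gamma>. v \<in> e}"

definition zagreb1 :: "'v ugraph \<Rightarrow> nat" where
  "zagreb1 \<Gamma> = (\<Sum>v\<in>vertices \<Gamma>. (degree \<Gamma> v)\<^sup>2)"

text \<open>For an edge \<open>e = {u, v}\<close> with \<open>u \<noteq> v\<close> the product below is \<open>deg u * deg v\<close>.\<close>

definition zagreb2 :: "'v ugraph \<Rightarrow> nat" where
  "zagreb2 \<Gamma> = (\<Sum>e\<in>edges \<Gamma>. \<Prod>v\<in>e. degree \<Gamma> v)"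

section \<open>The commuting conjugacy class graph\<close>

definition center :: "('a, 'b) monoid_scheme \<Rightarrow> 'a set" where
  "center G = {z \<in> carrier G. \<forall>g\<in>carrier G. z \<otimes>\<^bsub>G\<^esub> g = g \<otimes>\<^bsub>G\<^esub> z}"

definition conj_class :: "('a, 'b) monoid_scheme \<Rightarrow> 'a \<Rightarrow> 'a set" where
  "conj_class G x = {g \<otimes>\<^bsub>G\<^esub> x \<otimes>\<^bsub>G\<^esub> inv\<^bsub>G\<^esub> g | g. g \<in> carrier G}"

definition CCC :: "('a, 'b) monoid_scheme \<Rightarrow> 'a set ugraph" where
  "CCC G =
     (let V = conj_class G ` (carrier G - center G) in
      \<lparr>vertices = V,
       edges = {{X, Y} | X Y. X \<in> V \<and> Y \<in> V \<and> X \<noteq> Y \<and>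
                  (\<exists>x\<in>X. \<exists>y\<in>Y. x \<otimes>\<^bsub>G\<^esub> y = y \<otimes>\<^bsub>G\<^esub> x)}\<rparr>)"

end

theory Submission
  imports Defs
begin

text \<open>
  Every element of the group is \<open>a\<^sup>i b\<^sup>e\<close> for a unique \<open>i\<close> modulo \<open>4m\<close> and \<open>e \<in> {0, 1}\<close>; uniqueness
  holds because right multiplication of normal forms by letters defines an action of words that
  respects the relations. The center lies in \<open>\<langle>a\<rangle>\<close>, a noncentral element of \<open>\<langle>a\<rangle>\<close> has exactly two
  conjugates \<open>a\<^sup>i\<close> and \<open>a\<^bsup>(2m-1)i\<^esup>\<close>, and the conjugates of \<open>a\<^sup>i b\<close> are the \<open>a\<^sup>j b\<close> with
  \<open>j \<equiv> i\<close> modulo \<open>gcd (2m - 2) (4m)\<close>, which is 2 or 4. Hence the graph is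
  \<open>K\<^bsub>2m-1\<^esub> \<union> 2 K\<^sub>1\<close> for even \<open>m\<close> and \<open>K\<^bsub>2m-2\<^esub> \<union> K\<^sub>4\<close> for odd \<open>m\<close>. For odd \<open>m\<close> the inequality
  amounts to \<open>32 (m - 1) m (m - 3)\<^sup>2 \<ge> 0\<close>.
\<close>


section \<open>Disjoint unions of complete graphs\<close>

text \<open>The members of \<open>F\<close> are the vertex sets of the complete graphs. A singleton
  member has no two-element subset, so isolated vertices fit the same description.\<close>

locale clique_union =
  fixes \<Gamma> :: "'v ugraph" and F :: "'v set set"
  assumes finite_family: "finite F"
    and finite_clique: "C \<in> F \<Longrightarrow> finite C"
    and disjoint_cliques: "C \<in> F \<Longrightarrow> D \<in> F \<Longrightarrow> C \<noteq> D \<Longrightarrow> C \<inter> D = {}"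
    and vertices_eq: "vertices \<Gamma> = \<Union>F"
    and edges_eq: "edges \<Gamma> = (\<Union>C\<in>F. {e. e \<subseteq> C \<and> card e = 2})"
begin

text \<open>Disjointness confines every edge at \<open>v\<close> to \<open>C\<close>, and such edges
  correspond to the other vertices \<open>u\<close> of \<open>C\<close> through
  \<open>{v, u}\<close>.\<close>

lemma degree_eq:
  assumes "C \<in> F" "v \<in> C"
  shows "degree \<Gamma> v = card C - 1"
proof -
  have only: "D = C" if "D \<in> F" "v \<in> D" for D
    using disjoint_cliques[of C D] assms that by blast
  have "{e \<in> edges \<Gamma>. v \<in> e} = (\<lambda>u. {v, u}) ` (C - {v})"
  proof (intro equalityI subsetI)
    fix e assume e: "e \<in> {e \<in> edges \<Gamma>. v \<in> e}"
    then obtain D where "D \<in> F" "e \<subseteq> D" "card e = 2" "v \<in> e"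
      by (auto simp: edges_eq)
    moreover from this have "D = C" using only by blast
    ultimately show "e \<in> (\<lambda>u. {v, u}) ` (C - {v})"
      by (auto simp: card_2_iff)
  qed (use assms in \<open>auto simp: edges_eq card_2_iff intro!: bexI[of _ C]\<close>)
  moreover have "inj_on (\<lambda>u. {v, u}) (C - {v})"
    by (auto simp: inj_on_def doubleton_eq_iff)
  ultimately show ?thesis
    using assms finite_clique by (simp add: degree_def card_image)
qed

lemma card_vertices: "card (vertices \<Gamma>) = (\<Sum>C\<in>F. card C)"
  unfolding vertices_eq
  by (rule card_Union_disjoint)
     (auto simp: pairwise_def disjnt_def finite_clique disjoint_cliques)

lemma zagreb1_eq: "zagreb1 \<Gamma> = (\<Sum>C\<in>F. card C * (card C - 1)\<^sup>2)"
proof -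
  have "zagreb1 \<Gamma> = (\<Sum>C\<in>F. \<Sum>v\<in>C. (degree \<Gamma> v)\<^sup>2)"
    unfolding zagreb1_def vertices_eq
    by (subst sum.Union_disjoint) (auto simp: finite_clique disjoint_cliques)
  then show ?thesis by (simp add: degree_eq)
qed

text \<open>Two different cliques share no vertex, hence no two-element set, so the edge set is
  itself a disjoint union over \<open>F\<close>.\<close>

lemma sum_edges: "(\<Sum>e\<in>edges \<Gamma>. f e) = (\<Sum>C\<in>F. \<Sum>e | e \<subseteq> C \<and> card e = 2. f e)"
  unfolding edges_eq
proof (rule sum.UNION_disjoint[OF finite_family])
  show "\<forall>C\<in>F. finite {e. e \<subseteq> C \<and> card e = 2}"
    using finite_clique by simp
  show "\<forall>C\<in>F. \<forall>D\<in>F. C \<noteq> D \<longrightarrow>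
      {e. e \<subseteq> C \<and> card e = 2} \<inter> {e. e \<subseteq> D \<and> card e = 2} = {}"
  proof (intro ballI impI equals0I)
    fix C D e assume "C \<in> F" "D \<in> F" "C \<noteq> D"
      and e: "e \<in> {e. e \<subseteq> C \<and> card e = 2} \<inter> {e. e \<subseteq> D \<and> card e = 2}"
    then have "e \<subseteq> {}" using disjoint_cliques[of C D] by blast
    with e show False by simp
  qed
qed

lemma card_edges: "card (edges \<Gamma>) = (\<Sum>C\<in>F. card C choose 2)"
  using sum_edges[of "\<lambda>_. 1::nat"] by (simp add: n_subsets finite_clique)

text \<open>Both ends of an edge lie in one clique and so have the same degree; every edge of
  \<open>C\<close> contributes the same square.\<close>

lemma zagreb2_eq: "zagreb2 \<Gamma> = (\<Sum>C\<in>F. (card C choose 2) * (card C - 1)\<^sup>2)"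
proof -
  have "(\<Prod>v\<in>e. degree \<Gamma> v) = (card C - 1)\<^sup>2" if "C \<in> F" "e \<subseteq> C" "card e = 2" for C e
  proof -
    have "(\<Prod>v\<in>e. degree \<Gamma> v) = (\<Prod>v\<in>e. card C - 1)"
      using that degree_eq by (intro prod.cong) auto
    then show ?thesis using that by simp
  qed
  then show ?thesis
    unfolding zagreb2_def sum_edges by (simp add: n_subsets finite_clique)
qed

end

section \<open>Normal forms in the semidihedral group\<close>

text \<open>This is the exponent \<open>t\<close> in \<open>b^e a = a^t b^e\<close>, the cost of
  moving \<open>a\<close> to the left past \<open>b^e\<close>.\<close>

definition twist :: "nat \<Rightarrow> bool \<Rightarrow> int" where
  "twist m e = (if e then 2 * int m - 1 else 1)"

text \<open>Modulo \<open>4 * m\<close> the number \<open>2 * m - 1\<close> is its own inverse, so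
  multiplying by it exchanges the two values of \<open>twist\<close>.\<close>

lemma twist_not: "4 * int m dvd twist m (\<not> e) - (2 * int m - 1) * twist m e"
proof (cases e)
  case True
  have "1 - (2 * int m - 1) * (2 * int m - 1) = 4 * int m * (1 - int m)" 
    by (simp add: algebra_simps)
  with True show ?thesis by (simp add: twist_def)
qed (simp add: twist_def)

text \<open>The pair \<open>(i, e)\<close> stands for \<open>a\<^sup>i b\<^sup>e\<close>; a letter acts by multiplication from the right.\<close>

fun act :: "nat \<Rightarrow> sd_gen \<times> bool \<Rightarrow> int \<times> bool \<Rightarrow> int \<times> bool" where
  "act m (Gen_a, t) (i, e) = ((i + (if t then 1 else - 1) * twist m e) mod (4 * int m), e)"
| "act m (Gen_b, t) (i, e) = (i, \<not> e)"

text \<open>The generator \<open>a\<close> acts through remainders modulo \<open>4 * m\<close>, so a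
  letter followed by its inverse restores a state only if the exponent is already such a
  remainder.\<close>

abbreviation reduced :: "nat \<Rightarrow> int \<times> bool \<Rightarrow> bool" where
  "reduced m s \<equiv> 0 \<le> fst s \<and> fst s < 4 * int m"

lemma reduced_fold_act: "reduced m s \<Longrightarrow> reduced m (fold (act m) u s)"
proof (induction u arbitrary: s)
  case (Cons l u)
  have "reduced m (act m l s)"
    using Cons.prems by (cases "(m, l, s)" rule: act.cases) auto
  then show ?case using Cons.IH by simp
qed simp

lemma funpow_act:
  "reduced m (i, e) \<Longrightarrow>
    (act m (Gen_a, True) ^^ n) (i, e) = ((i + int n * twist m e) mod (4 * int m), e)"
  by (induction n) (auto simp: algebra_simps mod_simps)

definition sd_relations :: "nat \<Rightarrow> (sd_gen word \<times> sd_gen word) set" where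
  "sd_relations m =
     {(replicate (4 * m) (Gen_a, True), []),
      (replicate 2 (Gen_b, True), []),
      ([(Gen_b, True), (Gen_a, True), (Gen_b, True)], replicate (2 * m - 1) (Gen_a, True))}"

text \<open>It suffices to check cancellation and the three relations on reduced states. This makes
  the action an invariant of group elements, from which uniqueness of normal forms follows.\<close>

lemma fold_act_word_eq:
  assumes "word_eq (sd_relations m) u v" "m \<ge> 1" "reduced m s"
  shows "fold (act m) u s = fold (act m) v s"
  using assms
proof (induction arbitrary: s rule: word_eq.induct)
  case (word_eq_cancel u x t v)
  obtain i e where ie: "fold (act m) u s = (i, e)" by force
  then have "reduced m (i, e)" using reduced_fold_act[of s m u] word_eq_cancel by simp
  then have "fold (act m) [(x, t), (x, \<not> t)] (i, e) = (i, e)"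
    by (cases x) (auto simp: mod_simps)
  with ie show ?case by simp
next
  case (word_eq_relation l r u v)
  obtain i e where ie: "fold (act m) u s = (i, e)" by force
  then have red: "reduced m (i, e)" using reduced_fold_act[of s m u] word_eq_relation by simp
  \<comment> \<open>The two sides are the exponents reached from \<open>(i, e)\<close> by
    \<open>bab\<close> and by \<open>a^(2m-1)\<close>.\<close>
  have "(i + twist m (\<not> e)) mod (4 * int m) = (i + int (2 * m - 1) * twist m e) mod (4 * int m)"
    using twist_not[of m e] \<open>m \<ge> 1\<close> by (simp add: mod_eq_dvd_iff of_nat_diff)
  then have "fold (act m) l (i, e) = fold (act m) r (i, e)"
    using word_eq_relation.hyps red
    by (auto simp: sd_relations_def funpow_act numeral_2_eq_2)
  with ie show ?case by simp
qed auto

text \<open>Everything after the construction of normal forms rests on these properties alone, with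
  \<open>nf i e\<close> read as \<open>a^i b^e\<close>. Integer exponents keep subtraction free of
  truncation.\<close>

locale semidihedral = group G for G (structure) +
  fixes m :: nat and nf :: "int \<Rightarrow> bool \<Rightarrow> 'a"
  assumes m_ge_2: "m \<ge> 2"
    and nf_mult: "nf i e \<otimes> nf j f = nf (i + twist m e * j) (e \<noteq> f)"
    and carrier_eq: "carrier G = range (case_prod nf)"
    and nf_eq_iff: "nf i e = nf j f \<longleftrightarrow> e = f \<and> 4 * int m dvd i - j"

section \<open>Existence and uniqueness of normal forms in the presented group\<close>

context
  fixes m :: nat
  assumes m: "m \<ge> 2"
begin

interpretation P: group "presented_group (sd_relations m)"
  by (rule group_presented_group)

abbreviation "SD \<equiv> presented_group (sd_relations m)"
abbreviation "cls u \<equiv> word_rel (sd_relations m) `` {u}"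
abbreviation "ga \<equiv> cls [(Gen_a, True)]"
abbreviation "gb \<equiv> cls [(Gen_b, True)]"
definition "pnf i e = ga [^]\<^bsub>SD\<^esub> (i::int) \<otimes>\<^bsub>SD\<^esub> (if e then gb else \<one>\<^bsub>SD\<^esub>)"

lemma cls_carrier [simp]: "cls u \<in> carrier SD"
  by (simp add: presented_group_def quotientI)

lemma cls_Nil: "cls [] = \<one>\<^bsub>SD\<^esub>"
  by (simp add: presented_group_def)

lemma cls_append: "cls (u @ v) = cls u \<otimes>\<^bsub>SD\<^esub> cls v"
  by (simp add: presented_group_mult)

lemma cls_replicate: "cls (replicate n (Gen_a, True)) = ga [^]\<^bsub>SD\<^esub> n"
proof (induction n)
  case (Suc n)
  have "replicate (Suc n) (Gen_a, True) = replicate n (Gen_a, True) @ [(Gen_a, True)]"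
    by (simp add: replicate_append_same)
  then show ?case by (simp only: cls_append Suc P.nat_pow_Suc)
qed (simp add: cls_Nil)

lemma cls_relation:
  assumes "(l, r) \<in> sd_relations m"
  shows "cls l = cls r"
  using word_eq_relation[OF assms, of "[]" "[]"]
  by (simp only: word_class_eq_iff append.simps append_Nil2)

lemma cls_inverse: "cls [(x, False)] = inv\<^bsub>SD\<^esub> (cls [(x, True)])"
proof -
  have "cls [(x, False)] \<otimes>\<^bsub>SD\<^esub> cls [(x, True)] = \<one>\<^bsub>SD\<^esub>"
    using word_eq_cancel[of "sd_relations m" "[]" x False "[]"]
    by (simp only: presented_group_mult word_class_eq_iff cls_Nil[symmetric]) simp
  then show ?thesis using P.inv_equality by simp
qed

lemma gb_gb: "gb \<otimes>\<^bsub>SD\<^esub> gb = \<one>\<^bsub>SD\<^esub>"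
proof -
  have "cls [(Gen_b, True), (Gen_b, True)] = cls []"
    by (rule cls_relation) (simp add: sd_relations_def numeral_2_eq_2)
  then show ?thesis by (simp only: presented_group_mult append.simps cls_Nil)
qed

lemma ga_order: "ga [^]\<^bsub>SD\<^esub> (4 * int m) = \<one>\<^bsub>SD\<^esub>"
proof -
  have "cls (replicate (4 * m) (Gen_a, True)) = cls []"
    by (rule cls_relation) (simp add: sd_relations_def)
  then show ?thesis
    using int_pow_int[of SD ga "4 * m"] by (simp only: cls_replicate cls_Nil of_nat_mult) simp
qed

lemma ga_pow_cong:
  assumes "4 * int m dvd i - j"
  shows "ga [^]\<^bsub>SD\<^esub> i = ga [^]\<^bsub>SD\<^esub> j"
proof -
  obtain k where k: "i = 4 * int m * k + j" using assms by (metis dvd_def diff_eq_eq)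
  have "ga [^]\<^bsub>SD\<^esub> (4 * int m * k) = \<one>\<^bsub>SD\<^esub>"
    using P.int_pow_pow[of ga "4 * int m" k] by (simp add: ga_order)
  then show ?thesis by (simp add: k P.int_pow_mult)
qed

text \<open>Since \<open>b\<close> is its own inverse, \<open>x \<mapsto> b x b\<close> is an
  endomorphism. It sends \<open>a\<close> to \<open>a^(2m-1)\<close> by the third relation, hence
  \<open>a^j\<close> to \<open>a^((2m-1)j)\<close>.\<close>

lemma gb_ga_pow: "gb \<otimes>\<^bsub>SD\<^esub> ga [^]\<^bsub>SD\<^esub> (j::int) = ga [^]\<^bsub>SD\<^esub> ((2 * int m - 1) * j) \<otimes>\<^bsub>SD\<^esub> gb"
proof -
  let ?c = "\<lambda>x. gb \<otimes>\<^bsub>SD\<^esub> x \<otimes>\<^bsub>SD\<^esub> gb"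
  have hom: "group_hom SD SD ?c"
  proof (intro group_hom.intro group_hom_axioms.intro homI)
    fix x y assume xy: "x \<in> carrier SD" "y \<in> carrier SD"
    have "gb \<otimes>\<^bsub>SD\<^esub> x \<otimes>\<^bsub>SD\<^esub> gb \<otimes>\<^bsub>SD\<^esub> (gb \<otimes>\<^bsub>SD\<^esub> y \<otimes>\<^bsub>SD\<^esub> gb)
        = gb \<otimes>\<^bsub>SD\<^esub> x \<otimes>\<^bsub>SD\<^esub> ((gb \<otimes>\<^bsub>SD\<^esub> gb) \<otimes>\<^bsub>SD\<^esub> (y \<otimes>\<^bsub>SD\<^esub> gb))"
      using xy by (simp only: P.m_assoc P.m_closed cls_carrier)
    then show "gb \<otimes>\<^bsub>SD\<^esub> (x \<otimes>\<^bsub>SD\<^esub> y) \<otimes>\<^bsub>SD\<^esub> gb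
        = gb \<otimes>\<^bsub>SD\<^esub> x \<otimes>\<^bsub>SD\<^esub> gb \<otimes>\<^bsub>SD\<^esub> (gb \<otimes>\<^bsub>SD\<^esub> y \<otimes>\<^bsub>SD\<^esub> gb)"
      using xy by (simp add: gb_gb P.m_assoc)
  qed (auto simp: P.group_axioms)
  have "cls [(Gen_b, True), (Gen_a, True), (Gen_b, True)] = cls (replicate (2 * m - 1) (Gen_a, True))"
    by (rule cls_relation) (simp add: sd_relations_def)
  then have "?c ga = cls (replicate (2 * m - 1) (Gen_a, True))"
    by (simp only: presented_group_mult append.simps)
  then have base: "?c ga = ga [^]\<^bsub>SD\<^esub> (2 * int m - 1)"
    using int_pow_int[of SD ga "2 * m - 1"] m by (simp add: cls_replicate of_nat_diff)
  have "?c (ga [^]\<^bsub>SD\<^esub> j) = ?c ga [^]\<^bsub>SD\<^esub> j"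
    using group_hom.hom_int_pow[OF hom, of ga j] by simp
  also have "\<dots> = ga [^]\<^bsub>SD\<^esub> ((2 * int m - 1) * j)"
    by (simp add: base P.int_pow_pow)
  finally have "?c (ga [^]\<^bsub>SD\<^esub> j) \<otimes>\<^bsub>SD\<^esub> gb = ga [^]\<^bsub>SD\<^esub> ((2 * int m - 1) * j) \<otimes>\<^bsub>SD\<^esub> gb" by simp
  then show ?thesis by (simp add: P.m_assoc gb_gb)
qed

lemma pnf_mult: "pnf i e \<otimes>\<^bsub>SD\<^esub> pnf j f = pnf (i + twist m e * j) (e \<noteq> f)"
proof (cases e)
  case True
  have "pnf i e \<otimes>\<^bsub>SD\<^esub> pnf j f
      = ga [^]\<^bsub>SD\<^esub> i \<otimes>\<^bsub>SD\<^esub> (gb \<otimes>\<^bsub>SD\<^esub> ga [^]\<^bsub>SD\<^esub> j) \<otimes>\<^bsub>SD\<^esub> (if f then gb else \<one>\<^bsub>SD\<^esub>)"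
    using True by (simp add: pnf_def P.m_assoc)
  also have "\<dots> = ga [^]\<^bsub>SD\<^esub> i \<otimes>\<^bsub>SD\<^esub> ga [^]\<^bsub>SD\<^esub> ((2 * int m - 1) * j) \<otimes>\<^bsub>SD\<^esub>
      (gb \<otimes>\<^bsub>SD\<^esub> (if f then gb else \<one>\<^bsub>SD\<^esub>))"
    unfolding gb_ga_pow by (simp add: P.m_assoc)
  also have "gb \<otimes>\<^bsub>SD\<^esub> (if f then gb else \<one>\<^bsub>SD\<^esub>) = (if e \<noteq> f then gb else \<one>\<^bsub>SD\<^esub>)"
    using True by (simp add: gb_gb)
  finally show ?thesis
    using True by (simp add: pnf_def P.int_pow_mult twist_def)
next
  case False
  then show ?thesis by (simp add: pnf_def P.int_pow_mult twist_def P.m_assoc)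
qed

text \<open>Each letter is a normal form, and \<open>pnf_mult\<close> shows that appending one to a
  normal form gives a normal form again.\<close>

lemma pnf_surj: "\<exists>i e. cls u = pnf i e"
proof (induction u rule: rev_induct)
  case Nil
  have "cls [] = pnf 0 False" by (simp add: cls_Nil pnf_def)
  then show ?case by blast
next
  case (snoc l u)
  obtain x t where l: "l = (x, t)" by force
  have "inv\<^bsub>SD\<^esub> gb = gb" using gb_gb P.inv_equality by simp
  moreover have "pnf 1 False = ga" "pnf (- 1) False = inv\<^bsub>SD\<^esub> ga" "pnf 0 True = gb"
    by (simp_all add: pnf_def P.int_pow_neg)
  ultimately have "cls [l] = (case x of Gen_a \<Rightarrow> pnf (if t then 1 else - 1) False | Gen_b \<Rightarrow> pnf 0 True)"
    unfolding l by (cases x; cases t) (simp_all add: cls_inverse)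
  then have "\<exists>j f. cls [l] = pnf j f" by (cases x) auto
  with snoc show ?case
    unfolding cls_append by (metis pnf_mult)
qed

text \<open>Equal elements have canonical words that act alike. Applied to the state of the
  identity, such a word reveals the remainder of its exponent and the power of
  \<open>b\<close>.\<close>

lemma pnf_eq_iff: "pnf i e = pnf j f \<longleftrightarrow> e = f \<and> 4 * int m dvd i - j"
proof
  assume eq: "pnf i e = pnf j f"
  let ?w = "\<lambda>i e. replicate (nat (i mod (4 * int m))) (Gen_a, True) @ (if e then [(Gen_b, True)] else [])"
  have w: "pnf i e = cls (?w i e)" for i e
  proof -
    have "4 * int m dvd i - i mod (4 * int m)" by (simp add: mod_eq_dvd_iff[symmetric])
    then have "ga [^]\<^bsub>SD\<^esub> i = ga [^]\<^bsub>SD\<^esub> (i mod (4 * int m))" by (rule ga_pow_cong)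
    also have "\<dots> = ga [^]\<^bsub>SD\<^esub> (nat (i mod (4 * int m)))"
      using int_pow_int[of SD ga "nat (i mod (4 * int m))"] m by simp
    finally show ?thesis
      by (simp add: pnf_def cls_append cls_replicate cls_Nil del: Image_singleton_iff)
  qed
  have "fold (act m) (?w i e) (0, False) = (i mod (4 * int m), e)" for i e
    using m by (auto simp: funpow_act twist_def)
  moreover have "word_eq (sd_relations m) (?w i e) (?w j f)"
    using eq unfolding w word_class_eq_iff .
  ultimately have "(i mod (4 * int m), e) = (j mod (4 * int m), f)"
    using fold_act_word_eq[of m "?w i e" "?w j f" "(0, False)"] m by simp
  then show "e = f \<and> 4 * int m dvd i - j" by (simp add: mod_eq_dvd_iff)
qed (auto simp: pnf_def ga_pow_cong)

lemma semidihedral_pnf: "semidihedral SD m pnf"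
proof
  show "carrier SD = range (case_prod pnf)"
  proof (intro equalityI subsetI)
    fix X assume "X \<in> carrier SD"
    then obtain u where "X = cls u" by (auto simp: presented_group_def elim: quotientE)
    with pnf_surj[of u] show "X \<in> range (case_prod pnf)" by auto
  qed (auto simp: pnf_def)
qed (rule m pnf_mult pnf_eq_iff)+

end

text \<open>An isomorphism from the presented group carries its normal forms over to
  \<open>G\<close>, so the later arguments can take place in \<open>G\<close> itself.\<close>

lemma semidihedral_of_iso:
  assumes "m \<ge> 2" "group G" "G \<cong> semidihedral_group m"
  obtains nf where "semidihedral G m nf"
proof -
  let ?P = "presented_group (sd_relations m)"
  interpret P: semidihedral ?P m "pnf m" using assms(1) by (rule semidihedral_pnf)
  have "semidihedral_group m = ?P" by (simp add: semidihedral_group_def sd_relations_def Let_def)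
  then have "?P \<cong> G" using group.iso_sym[OF assms(2,3)] by simp
  then obtain h where h: "h \<in> iso ?P G" unfolding is_iso_def by blast
  then have hom: "h \<in> hom ?P G" and inj: "inj_on h (carrier ?P)" and im: "h ` carrier ?P = carrier G"
    by (auto simp: iso_def bij_betw_def)
  have [simp]: "pnf m i e \<in> carrier ?P" for i e using P.carrier_eq by auto
  have "semidihedral G m (\<lambda>i e. h (pnf m i e))"
  proof (intro semidihedral.intro semidihedral_axioms.intro assms)
    fix i e j f
    show "h (pnf m i e) \<otimes>\<^bsub>G\<^esub> h (pnf m j f) = h (pnf m (i + twist m e * j) (e \<noteq> f))"
      using hom_mult[OF hom, of "pnf m i e" "pnf m j f"] by (simp add: P.nf_mult)
    show "h (pnf m i e) = h (pnf m j f) \<longleftrightarrow> e = f \<and> 4 * int m dvd i - j"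
      using inj_on_eq_iff[OF inj, of "pnf m i e" "pnf m j f"] by (simp add: P.nf_eq_iff)
  next
    show "carrier G = range (\<lambda>(i, e). h (pnf m i e))"
      using im unfolding P.carrier_eq by (simp add: image_image case_prod_unfold)
  qed
  then show ?thesis by (rule that)
qed

section \<open>Conjugacy classes\<close>

context group
begin

text \<open>Clearing the inverse turns conjugacy into an equation between two products, which can be
  tested on normal forms without computing inverses.\<close>

lemma conj_class_iff:
  assumes "x \<in> carrier G"
  shows "y \<in> conj_class G x \<longleftrightarrow> y \<in> carrier G \<and> (\<exists>g\<in>carrier G. g \<otimes> x = y \<otimes> g)"
proof
  assume "y \<in> conj_class G x"
  then obtain g where "g \<in> carrier G" "y = g \<otimes> x \<otimes> inv g"
    by (auto simp: conj_class_def)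
  with assms show "y \<in> carrier G \<and> (\<exists>g\<in>carrier G. g \<otimes> x = y \<otimes> g)"
    by (auto simp: m_assoc intro!: bexI[of _ g])
next
  assume "y \<in> carrier G \<and> (\<exists>g\<in>carrier G. g \<otimes> x = y \<otimes> g)"
  then obtain g where "y \<in> carrier G" "g \<in> carrier G" "g \<otimes> x = y \<otimes> g" by blast
  then have "y = g \<otimes> x \<otimes> inv g" by (simp add: m_assoc)
  with \<open>g \<in> carrier G\<close> show "y \<in> conj_class G x" by (auto simp: conj_class_def)
qed

lemma conj_class_self: "x \<in> carrier G \<Longrightarrow> x \<in> conj_class G x"
  by (auto simp: conj_class_iff intro!: bexI[of _ \<one>])

lemma conj_class_subset:
  assumes "x \<in> carrier G" "y \<in> conj_class G x"
  shows "conj_class G y \<subseteq> conj_class G x"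
proof
  fix z assume z: "z \<in> conj_class G y"
  obtain g where g: "y \<in> carrier G" "g \<in> carrier G" "g \<otimes> x = y \<otimes> g"
    using assms conj_class_iff by blast
  with z obtain h where h: "z \<in> carrier G" "h \<in> carrier G" "h \<otimes> y = z \<otimes> h"
    using conj_class_iff by blast
  have "h \<otimes> g \<otimes> x = h \<otimes> y \<otimes> g" using g h(1,2) assms by (simp add: m_assoc)
  also have "\<dots> = z \<otimes> (h \<otimes> g)" using g h by (simp add: m_assoc[symmetric])
  finally show "z \<in> conj_class G x"
    using g h assms(1) unfolding conj_class_iff[OF assms(1)] by blast
qed

lemma conj_class_sym:
  assumes "x \<in> carrier G" "y \<in> conj_class G x"
  shows "x \<in> conj_class G y"
proof -
  obtain g where g: "y \<in> carrier G" "g \<in> carrier G" "g \<otimes> x = y \<otimes> g"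
    using assms conj_class_iff by blast
  then have "inv g \<otimes> y = inv g \<otimes> (y \<otimes> g) \<otimes> inv g"
    by (simp add: m_assoc)
  also have "\<dots> = x \<otimes> inv g" using g assms by (simp add: g(3)[symmetric]) (simp add: m_assoc[symmetric])
  finally show ?thesis using g assms by (auto simp: conj_class_iff intro!: bexI[of _ "inv g"])
qed

lemma conj_class_eq:
  "x \<in> carrier G \<Longrightarrow> y \<in> conj_class G x \<Longrightarrow> conj_class G y = conj_class G x"
  using conj_class_subset conj_class_sym conj_class_iff by (metis equalityI)

lemma conj_class_eq_iff:
  "x \<in> carrier G \<Longrightarrow> y \<in> carrier G \<Longrightarrow> conj_class G x = conj_class G y \<longleftrightarrow> y \<in> conj_class G x"
  using conj_class_eq conj_class_self by metis

lemma conj_class_disjoint: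
  "x \<in> carrier G \<Longrightarrow> y \<in> carrier G \<Longrightarrow> conj_class G x \<noteq> conj_class G y \<Longrightarrow>
    conj_class G x \<inter> conj_class G y = {}"
  using conj_class_eq by blast

end

section \<open>Commutation and conjugacy in the semidihedral group\<close>

context semidihedral
begin

lemma nf_carrier [simp]: "nf i e \<in> carrier G"
  by (auto simp: carrier_eq)

text \<open>
  \<open>d = gcd (2m - 2) (4m)\<close> is both the order of the center and the number of conjugacy classes
  outside \<open>\<langle>a\<rangle>\<close>; the center is generated by \<open>a\<^sup>z\<close>.
\<close>

definition d :: nat where "d = (if even m then 2 else 4)"

definition z :: nat where "z = (if even m then 2 * m else m)"

lemma d_z: "d * z = 4 * m" "d > 0" "z > 0"
  using m_ge_2 by (auto simp: d_def z_def)

lemma z_dvd: "int z dvd 4 * int m"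
  by (simp add: z_def)

lemma d_dvd: "int d dvd 4 * int m" "int d dvd 2 * int m - 2"
  by (auto simp: d_def elim!: oddE evenE)

text \<open>The factor \<open>2 * m - 2\<close> is the difference of the two values of
  \<open>twist\<close>, so it measures failure to commute. For even \<open>m\<close> cancel 2 and
  use that \<open>m - 1\<close> is coprime to \<open>2 * m\<close>; for \<open>m = 2 * k + 1\<close>
  cancel 4 and use that \<open>k\<close> is coprime to \<open>m\<close>.\<close>

lemma twist_diff_dvd_iff: "4 * int m dvd (2 * int m - 2) * x \<longleftrightarrow> int z dvd x"
proof (cases "even m")
  case True
  then have "coprime 2 (int m - 1)" by simp
  moreover have "coprime (int m) (int m - 1)" by simp
  ultimately have "coprime (2 * int m) (int m - 1)" by simp
  then have "2 * int m dvd (int m - 1) * x \<longleftrightarrow> 2 * int m dvd x"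
    by (rule coprime_dvd_mult_right_iff)
  moreover have eq: "(2 * int m - 2) * x = 2 * ((int m - 1) * x)"
    by (simp add: algebra_simps)
  have "4 * int m dvd (2 * int m - 2) * x \<longleftrightarrow> 2 * int m dvd (int m - 1) * x"
    unfolding eq using dvd_mult_cancel_left[of 2 "2 * int m" "(int m - 1) * x"] by simp
  ultimately show ?thesis using True by (simp add: z_def)
next
  case False
  then obtain k where k: "m = 2 * k + 1" by (elim oddE)
  have "coprime (int m) (int k)"
  proof (rule coprimeI)
    fix c assume "c dvd int m" "c dvd int k"
    then have "c dvd int m - 2 * int k" by (intro dvd_diff dvd_mult)
    then show "is_unit c" by (simp add: k)
  qed
  then have "int m dvd int k * x \<longleftrightarrow> int m dvd x"
    by (rule coprime_dvd_mult_right_iff)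
  moreover have eq: "(2 * int m - 2) * x = 4 * (int k * x)" by (simp add: k)
  have "4 * int m dvd (2 * int m - 2) * x \<longleftrightarrow> int m dvd int k * x"
    unfolding eq by simp
  ultimately show ?thesis using False by (simp add: z_def)
qed

text \<open>As \<open>d\<close> is the gcd of \<open>2 * m - 2\<close> and \<open>4 * m\<close>, the
  multiples of \<open>2 * m - 2\<close> cover exactly the multiples of \<open>d\<close> modulo
  \<open>4 * m\<close>. Bezout coefficients are given explicitly.\<close>

lemma twist_diff_generates:
  "(\<exists>k. 4 * int m dvd x + (2 * int m - 2) * k) \<longleftrightarrow> int d dvd x"
proof
  assume "\<exists>k. 4 * int m dvd x + (2 * int m - 2) * k"
  then obtain k where "4 * int m dvd x + (2 * int m - 2) * k" by blast
  with d_dvd(1) have "int d dvd x + (2 * int m - 2) * k" by (rule dvd_trans)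
  then show "int d dvd x" using d_dvd(2) by (simp add: dvd_add_left_iff)
next
  assume "int d dvd x"
  then obtain q where q: "x = (if even m then 2 else 4) * q" by (auto simp: d_def)
  show "\<exists>k. 4 * int m dvd x + (2 * int m - 2) * k"
  proof (cases "even m")
    case True
    then obtain n where n: "m = 2 * n" by blast
    \<comment> \<open>The factor \<open>2 * n + 1\<close> is \<open>m + 1\<close>: from
      \<open>(m - 1) * (m + 1) = m^2 - 1\<close> the sum collapses to
      \<open>2 * m^2 * q\<close>.\<close>
    have "x + (2 * int m - 2) * ((2 * int n + 1) * q) = 4 * int m * (int n * q)"
      by (simp add: q n algebra_simps)
    then show ?thesis by (metis dvd_triv_left)
  next
    case False
    then obtain n where n: "m = 2 * n + 1" by (elim oddE)
    have "x + (2 * int m - 2) * (2 * q) = 4 * int m * q"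
      by (simp add: q n algebra_simps)
    then show ?thesis by (metis dvd_triv_left)
  qed
qed

lemma rot_commute: "nf i False \<otimes> nf j False = nf j False \<otimes> nf i False"
  by (simp add: nf_mult twist_def add.commute)

lemma rot_refl_commute_iff:
  "nf i False \<otimes> nf j True = nf j True \<otimes> nf i False \<longleftrightarrow> int z dvd i"
proof -
  have "nf i False \<otimes> nf j True = nf j True \<otimes> nf i False \<longleftrightarrow> 4 * int m dvd - ((2 * int m - 2) * i)"
    by (simp add: nf_mult nf_eq_iff twist_def algebra_simps)
  then show ?thesis by (simp only: dvd_minus_iff twist_diff_dvd_iff)
qed

lemma refl_commute_iff:
  "nf i True \<otimes> nf j True = nf j True \<otimes> nf i True \<longleftrightarrow> int z dvd j - i"
proof -
  have "nf i True \<otimes> nf j True = nf j True \<otimes> nf i True \<longleftrightarrow> 4 * int m dvd (2 * int m - 2) * (j - i)"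
    by (simp add: nf_mult nf_eq_iff twist_def algebra_simps)
  then show ?thesis by (simp only: twist_diff_dvd_iff)
qed

text \<open>Powers of \<open>a\<close> commute with each other, so only commutation with the
  elements \<open>a^j b\<close> matters, and that condition does not depend on
  \<open>j\<close>.\<close>

lemma rot_central_iff: "nf i False \<in> center G \<longleftrightarrow> int z dvd i"
proof
  assume "nf i False \<in> center G"
  then have "\<forall>g\<in>carrier G. nf i False \<otimes> g = g \<otimes> nf i False"
    unfolding center_def by simp
  from bspec[OF this nf_carrier] have "nf i False \<otimes> nf 0 True = nf 0 True \<otimes> nf i False" .
  then show "int z dvd i" by (simp add: rot_refl_commute_iff)
next
  assume "int z dvd i"
  then have "nf i False \<otimes> nf j f = nf j f \<otimes> nf i False" for j f
    using rot_commute[of i j] rot_refl_commute_iff[of i j] by (cases f) simp_all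
  then have "\<forall>g\<in>carrier G. nf i False \<otimes> g = g \<otimes> nf i False"
    unfolding carrier_eq by (simp add: case_prod_unfold)
  then show "nf i False \<in> center G" unfolding center_def by simp
qed

lemma refl_not_central: "nf i True \<notin> center G"
proof
  assume "nf i True \<in> center G"
  then have "\<forall>g\<in>carrier G. nf i True \<otimes> g = g \<otimes> nf i True"
    unfolding center_def by simp
  from bspec[OF this nf_carrier] have "nf 1 False \<otimes> nf i True = nf i True \<otimes> nf 1 False" by (rule sym)
  then have "int z dvd 1" by (simp only: rot_refl_commute_iff)
  then show False using m_ge_2 by (simp add: z_def split: if_splits)
qed

lemma ex_carrier_iff: "(\<exists>g\<in>carrier G. Q g) \<longleftrightarrow> (\<exists>k e. Q (nf k e))"
  by (auto simp: carrier_eq)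

text \<open>Conjugation by \<open>a^k\<close> fixes \<open>a^i\<close>, and conjugation by
  \<open>a^k b\<close> multiplies its exponent by \<open>2 * m - 1\<close>.\<close>

lemma conj_class_rot:
  "conj_class G (nf i False) = {nf i False, nf ((2 * int m - 1) * i) False}"
proof (intro equalityI subsetI)
  fix y assume "y \<in> conj_class G (nf i False)"
  then obtain k e where y: "y \<in> carrier G" "nf k e \<otimes> nf i False = y \<otimes> nf k e"
    by (auto simp: conj_class_iff ex_carrier_iff)
  then obtain j f where jf: "y = nf j f" by (auto simp: carrier_eq)
  have f: "\<not> f" and "4 * int m dvd k + twist m e * i - (j + twist m f * k)"
    using y(2) by (auto simp: jf nf_mult nf_eq_iff)
  then have "4 * int m dvd twist m e * i - j" by (simp add: twist_def)
  with f have "\<not> f \<and> 4 * int m dvd j - twist m e * i" by (simp add: dvd_diff_commute)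
  then show "y \<in> {nf i False, nf ((2 * int m - 1) * i) False}"
    by (cases e) (auto simp: jf nf_eq_iff twist_def)
next
  have "nf 0 e \<otimes> nf i False = nf (twist m e * i) False \<otimes> nf 0 e" for e
    by (simp add: nf_mult twist_def)
  then have *: "nf (twist m e * i) False \<in> conj_class G (nf i False)" for e
    by (subst conj_class_iff) (simp, metis nf_carrier)
  fix y assume "y \<in> {nf i False, nf ((2 * int m - 1) * i) False}"
  then show "y \<in> conj_class G (nf i False)"
    using *[of True] *[of False] by (auto simp: twist_def)
qed

text \<open>Conjugation by \<open>a^k\<close> shifts the exponent of \<open>a^i b\<close> by
  \<open>-(2m-2)k\<close>, and conjugation by \<open>b\<close> shifts it by \<open>(2m-2)i\<close>.
  All these shifts are multiples of \<open>d\<close>, and the powers of \<open>a\<close> already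
  realise every such multiple modulo \<open>4 * m\<close>.\<close>

lemma conj_class_refl: "conj_class G (nf i True) = {nf j True | j. int d dvd j - i}"
proof (intro equalityI subsetI)
  fix y assume "y \<in> conj_class G (nf i True)"
  then obtain k e where y: "y \<in> carrier G" "nf k e \<otimes> nf i True = y \<otimes> nf k e"
    by (auto simp: conj_class_iff ex_carrier_iff)
  then obtain j f where jf: "y = nf j f" by (auto simp: carrier_eq)
  have f: "f" and "4 * int m dvd k + twist m e * i - (j + (2 * int m - 1) * k)"
    using y(2) by (auto simp: jf nf_mult nf_eq_iff twist_def)
  then have "int d dvd k + twist m e * i - (j + (2 * int m - 1) * k)"
    using d_dvd(1) by (blast intro: dvd_trans)
  moreover have "k + twist m e * i - (j + (2 * int m - 1) * k)
      = (2 * int m - 2) * ((if e then i else 0) - k) - (j - i)"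
    by (simp add: twist_def algebra_simps)
  ultimately have "int d dvd j - i"
    using d_dvd(2) by (metis dvd_diff_right_iff dvd_mult2)
  moreover have "y = nf j True" using jf f by simp
  ultimately show "y \<in> {nf j True | j. int d dvd j - i}" by blast
next
  fix y assume "y \<in> {nf j True | j. int d dvd j - i}"
  then obtain j where y: "y = nf j True" and "int d dvd j - i" by blast
  then obtain k where "4 * int m dvd j - i + (2 * int m - 2) * k"
    using twist_diff_generates by blast
  then have "4 * int m dvd i - (j + (2 * int m - 2) * k)"
    by (subst dvd_diff_commute) (simp add: algebra_simps)
  then have "nf k False \<otimes> nf i True = y \<otimes> nf k False"
    by (simp add: y nf_mult nf_eq_iff twist_def algebra_simps)
  then show "y \<in> conj_class G (nf i True)" by (auto simp: y conj_class_iff)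
qed

section \<open>Vertices and edges of the commuting conjugacy class graph\<close>

abbreviation "rots \<equiv> {nf i False | i. \<not> int z dvd i}"
abbreviation "rot_classes \<equiv> conj_class G ` rots"
abbreviation "refl_classes \<equiv> conj_class G ` {nf i True | i. True}"

lemma vertices_CCC: "vertices (CCC G) = rot_classes \<union> refl_classes"
proof -
  have "carrier G - center G = rots \<union> {nf i True | i. True}"
    using rot_central_iff refl_not_central by (auto simp: carrier_eq) (metis (full_types))
  then show ?thesis by (simp add: CCC_def Let_def image_Un)
qed

lemma rots_conj_closed: "x \<in> rots \<Longrightarrow> conj_class G x \<subseteq> rots"
proof -
  assume "x \<in> rots"
  then obtain i where i: "x = nf i False" "\<not> int z dvd i" by blast
  \<comment> \<open>Multiplication by \<open>2 * m - 1\<close> is an involution modulo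
    \<open>4 * m\<close>, hence modulo its divisor \<open>z\<close>, so the second conjugate is
    noncentral as well.\<close>
  have "int z dvd i" if zd: "int z dvd (2 * int m - 1) * i"
  proof -
    have "int z dvd 4 * int m * (1 - int m) * i"
      using z_dvd by (simp only: dvd_mult2)
    moreover have "i = (2 * int m - 1) * ((2 * int m - 1) * i) + 4 * int m * (1 - int m) * i"
      by (simp add: algebra_simps)
    ultimately show ?thesis using zd by (metis dvd_add dvd_mult)
  qed
  with i show ?thesis by (auto simp: conj_class_rot)
qed

text \<open>Of the \<open>4 * m\<close> powers of \<open>a\<close>, exactly \<open>d\<close> are
  central, and the others split into classes of size two.\<close>

lemma finite_rot_classes: "finite rot_classes" and card_rot_classes: "2 * card rot_classes = 4 * m - d"
proof -
  \<comment> \<open>These are the remainders modulo \<open>4 * m\<close> with the \<open>d\<close>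
    multiples of \<open>z\<close> removed, one exponent for each noncentral power of
    \<open>a\<close>.\<close>
  let ?I = "{0..<4 * int m} - (\<lambda>k. int z * k) ` {0..<int d}"
  have I: "i \<in> ?I \<longleftrightarrow> i \<in> {0..<4 * int m} \<and> \<not> int z dvd i" for i
  proof -
    have "k \<in> {0..<int d}" if "int z * k \<in> {0..<4 * int m}" for k
    proof -
      have "int z * k < int z * int d"
        using that d_z(1) by (simp add: mult.commute flip: of_nat_mult)
      moreover have "0 \<le> int z * k" using that by simp
      ultimately show ?thesis using d_z(3) by (simp add: zero_le_mult_iff)
    qed
    then have "i \<in> (\<lambda>k. int z * k) ` {0..<int d}" if "i \<in> {0..<4 * int m}" "int z dvd i"
      using that unfolding dvd_def by blast
    then show ?thesis by fastforce
  qed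
  have inj: "inj_on (\<lambda>i. nf i False) {0..<4 * int m}"
  proof (rule inj_onI)
    fix i j assume "i \<in> {0..<4 * int m}" "j \<in> {0..<4 * int m}" "nf i False = nf j False"
    then show "i = j"
      by (simp add: nf_eq_iff mod_eq_dvd_iff[symmetric])
  qed
  have rots: "rots = (\<lambda>i. nf i False) ` ?I"
  proof (intro equalityI subsetI)
    fix x assume "x \<in> rots"
    then obtain i where i: "x = nf i False" "\<not> int z dvd i" by blast
    have mod: "4 * int m dvd i - i mod (4 * int m)" by (simp add: mod_eq_dvd_iff[symmetric])
    moreover have "int z dvd i - i mod (4 * int m)"
      using z_dvd mod by (rule dvd_trans)
    ultimately have "x = nf (i mod (4 * int m)) False" "\<not> int z dvd i mod (4 * int m)"
      using i mod dvd_add[of "int z" "i - i mod (4 * int m)" "i mod (4 * int m)"]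
      by (auto simp: nf_eq_iff)
    then show "x \<in> (\<lambda>i. nf i False) ` ?I"
      using m_ge_2 by (intro image_eqI[of _ _ "i mod (4 * int m)"]) (auto simp: I simp del: Diff_iff)
  qed (use I in blast)
  have fin: "finite rots" unfolding rots by simp
  then show finite_classes: "finite rot_classes" by simp
  have "card ((\<lambda>k. int z * k) ` {0..<int d}) = d"
    using d_z(3) by (subst card_image) (auto simp: inj_on_def)
  moreover have "(\<lambda>k. int z * k) ` {0..<int d} \<subseteq> {0..<4 * int m}"
  proof
    fix x assume "x \<in> (\<lambda>k. int z * k) ` {0..<int d}"
    then obtain k where k: "x = int z * k" "0 \<le> k" "k < int d"
      by (meson atLeastLessThan_iff imageE)
    then have "int z * k < int z * int d" using d_z(3) by simp
    with k d_z(1) show "x \<in> {0..<4 * int m}"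
      by (simp add: mult.commute flip: of_nat_mult)
  qed
  ultimately have "card ?I = 4 * m - d"
    by (subst card_Diff_subset) (auto simp: nat_mult_distrib)
  moreover have "inj_on (\<lambda>i. nf i False) ?I" using inj by (rule inj_on_subset) auto
  ultimately have card_rots: "card rots = 4 * m - d" unfolding rots by (simp add: card_image)
  have union: "\<Union>rot_classes = rots"
  proof (intro equalityI subsetI)
    fix x assume "x \<in> rots"
    moreover from this have "x \<in> conj_class G x" by (auto intro: conj_class_self)
    ultimately show "x \<in> \<Union>rot_classes" by blast
  qed (use rots_conj_closed in blast)
  have "2 * card rot_classes = card (\<Union>rot_classes)"
  proof (rule card_partition[OF finite_classes])
    show "finite (\<Union>rot_classes)" using union fin by simp
    show "card C = 2" if C: "C \<in> rot_classes" for C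
    proof -
      obtain i where i: "C = conj_class G (nf i False)" "\<not> int z dvd i" using C by blast
      \<comment> \<open>The two listed conjugates coincide only if \<open>z\<close> divides
        \<open>i\<close>, that is, only for central elements.\<close>
      then have "\<not> 4 * int m dvd (2 * int m - 2) * i" by (simp only: twist_diff_dvd_iff not_False_eq_True)
      then have "nf ((2 * int m - 1) * i) False \<noteq> nf i False"
        by (simp add: nf_eq_iff algebra_simps)
      then show ?thesis by (simp add: i conj_class_rot eq_commute)
    qed
    show "C \<inter> D = {}" if CD: "C \<in> rot_classes" "D \<in> rot_classes" "C \<noteq> D" for C D
    proof -
      obtain x y where "C = conj_class G x" "D = conj_class G y" "x \<in> carrier G" "y \<in> carrier G"
        using CD nf_carrier by blast
      then show ?thesis using CD(3) conj_class_disjoint by simp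
    qed
  qed
  with union card_rots show "2 * card rot_classes = 4 * m - d" by simp
qed

lemma conj_class_refl_eq_iff:
  "conj_class G (nf i True) = conj_class G (nf j True) \<longleftrightarrow> int d dvd j - i"
proof -
  have "conj_class G (nf i True) = conj_class G (nf j True) \<longleftrightarrow> nf j True \<in> conj_class G (nf i True)"
    by (rule conj_class_eq_iff) simp_all
  moreover have "int d dvd j - i" if "4 * int m dvd j - k" "int d dvd k - i" for k
    using dvd_add[OF dvd_trans[OF d_dvd(1) that(1)] that(2)] by simp
  ultimately show ?thesis
    by (auto simp: conj_class_refl nf_eq_iff)
qed

text \<open>The remainders modulo \<open>d\<close> serve as exponents of representatives, one for
  each class outside \<open>\<langle>a\<rangle>\<close>.\<close>

lemma finite_refl_classes: "finite refl_classes" and card_refl_classes: "card refl_classes = d"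
proof -
  have eq: "refl_classes = (\<lambda>i. conj_class G (nf i True)) ` {0..<int d}"
  proof (intro equalityI subsetI)
    fix C assume "C \<in> refl_classes"
    then obtain i where C: "C = conj_class G (nf i True)" by blast
    have "int d dvd i mod int d - i" by (simp add: mod_eq_dvd_iff[symmetric])
    then have "C = conj_class G (nf (i mod int d) True)"
      unfolding C by (simp only: conj_class_refl_eq_iff)
    then show "C \<in> (\<lambda>i. conj_class G (nf i True)) ` {0..<int d}"
      using d_z(2) by auto
  qed auto
  show "finite refl_classes" unfolding eq by simp
  have "inj_on (\<lambda>i. conj_class G (nf i True)) {0..<int d}"
    by (rule inj_onI) (auto simp: conj_class_refl_eq_iff mod_eq_dvd_iff[symmetric])
  then show "card refl_classes = d" unfolding eq by (simp add: card_image)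
qed

lemma rot_refl_classes_disjoint: "rot_classes \<inter> refl_classes = {}"
proof (rule equals0I)
  fix C assume "C \<in> rot_classes \<inter> refl_classes"
  then obtain i j where "C = conj_class G (nf i False)" "C = conj_class G (nf j True)" by blast
  then have "nf i False \<in> conj_class G (nf j True)" using conj_class_self by auto
  then show False by (auto simp: conj_class_refl nf_eq_iff)
qed

text \<open>Classes inside \<open>\<langle>a\<rangle>\<close> are pairwise adjacent because
  \<open>\<langle>a\<rangle>\<close> is abelian, and their noncentral elements commute with no
  \<open>a^j b\<close>. Elements \<open>a^i b\<close> and \<open>a^j b\<close> commute when
  \<open>i\<close> and \<open>j\<close> agree modulo \<open>z\<close>: for even \<open>m\<close>
  this forces conjugacy, as \<open>d\<close> divides \<open>z\<close>; for odd \<open>m\<close>,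
  \<open>d\<close> and \<open>z\<close> are coprime and any two classes contain commuting
  elements.\<close>

lemma edges_CCC:
  "edges (CCC G) =
    {e. e \<subseteq> rot_classes \<and> card e = 2} \<union> (if even m then {} else {e. e \<subseteq> refl_classes \<and> card e = 2})"
proof -
  define V where "V = rot_classes \<union> refl_classes"
  define adj where "adj X Y \<longleftrightarrow> (\<exists>x\<in>X. \<exists>y\<in>Y. x \<otimes> y = y \<otimes> x)" for X Y
  have E: "edges (CCC G) = {{X, Y} | X Y. X \<in> V \<and> Y \<in> V \<and> X \<noteq> Y \<and> adj X Y}"
    using vertices_CCC by (simp add: CCC_def Let_def adj_def V_def)
  have adj_sym: "adj X Y \<longleftrightarrow> adj Y X" for X Y
    unfolding adj_def by metis
  have rot_rot: "adj X Y" if XY: "X \<in> rot_classes" "Y \<in> rot_classes" for X Y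
  proof -
    obtain i j where ij: "X = conj_class G (nf i False)" "Y = conj_class G (nf j False)"
      using XY by blast
    then show ?thesis unfolding adj_def
      using rot_commute[of i j] conj_class_self[OF nf_carrier] by blast
  qed
  have rot_refl: "\<not> adj X Y" if XY: "X \<in> rot_classes" "Y \<in> refl_classes" for X Y
  proof
    assume "adj X Y"
    then obtain x y where xy: "x \<in> X" "y \<in> Y" "x \<otimes> y = y \<otimes> x" unfolding adj_def by blast
    have "x \<in> rots" using XY(1) xy(1) rots_conj_closed by blast
    moreover obtain j where "y = nf j True" using XY(2) xy(2) by (auto simp: conj_class_refl)
    ultimately show False using xy(3) rot_refl_commute_iff by blast
  qed
  have refl_refl: "odd m" if XY: "X \<in> refl_classes" "Y \<in> refl_classes" "X \<noteq> Y" "adj X Y" for X Y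
  proof
    assume "even m"
    obtain x y where xy: "x \<in> X" "y \<in> Y" "x \<otimes> y = y \<otimes> x" using XY(4) unfolding adj_def by blast
    obtain i j where ij: "X = conj_class G (nf i True)" "Y = conj_class G (nf j True)"
      using XY by blast
    obtain k l where kl: "x = nf k True" "y = nf l True"
      using xy ij by (auto simp: conj_class_refl)
    have "int d dvd int z" using \<open>even m\<close> by (simp add: d_def z_def)
    moreover have "int z dvd l - k" using xy(3) by (simp add: kl refl_commute_iff)
    ultimately have "conj_class G x = conj_class G y"
      unfolding kl conj_class_refl_eq_iff by (rule dvd_trans)
    moreover have "conj_class G x = X" "conj_class G y = Y"
      using xy ij conj_class_eq nf_carrier by metis+
    ultimately show False using XY(3) by simp
  qed
  text \<open>For odd \<open>m\<close> we have \<open>z = m\<close>, \<open>d = 4\<close> and \<open>m\<^sup>2 \<equiv> 1 (mod 4)\<close>, so \<open>k\<close> below is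
    congruent to \<open>i\<close> modulo \<open>z\<close> and to \<open>j\<close> modulo \<open>d\<close>.\<close>
  have refl_refl_odd: "adj X Y" if odd: "odd m" and XY: "X \<in> refl_classes" "Y \<in> refl_classes" for X Y
  proof -
    obtain i j where ij: "X = conj_class G (nf i True)" "Y = conj_class G (nf j True)"
      using XY by blast
    define k where "k = i + int m * int m * (j - i)"
    obtain n where n: "m = 2 * n + 1" using odd by (elim oddE)
    have "k - j = 4 * ((int n * int n + int n) * (j - i))"
      by (simp add: k_def n algebra_simps)
    then have "nf k True \<in> Y" using odd by (auto simp: ij conj_class_refl d_def intro!: exI[of _ k])
    moreover have "int z dvd k - i" using odd by (simp add: k_def z_def)
    then have "nf i True \<otimes> nf k True = nf k True \<otimes> nf i True" by (simp only: refl_commute_iff)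
    moreover have "nf i True \<in> X" unfolding ij using conj_class_self by simp
    ultimately show ?thesis unfolding adj_def by blast
  qed
  have adj_iff: "adj X Y \<longleftrightarrow> X \<in> rot_classes \<and> Y \<in> rot_classes
      \<or> odd m \<and> X \<in> refl_classes \<and> Y \<in> refl_classes"
    if "X \<in> V" "Y \<in> V" "X \<noteq> Y" for X Y
  proof -
    define R where "R = rot_classes"
    define B where "B = refl_classes"
    show ?thesis
      using that rot_rot rot_refl refl_refl refl_refl_odd adj_sym
      unfolding V_def R_def[symmetric] B_def[symmetric] by (metis Un_iff)
  qed
  show ?thesis
  proof (intro equalityI subsetI)
    fix e assume "e \<in> edges (CCC G)"
    then obtain X Y where e: "e = {X, Y}" "X \<in> V" "Y \<in> V" "X \<noteq> Y" "adj X Y" unfolding E by blast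
    with adj_iff[of X Y] show "e \<in> {e. e \<subseteq> rot_classes \<and> card e = 2} \<union>
        (if even m then {} else {e. e \<subseteq> refl_classes \<and> card e = 2})"
      by auto
  next
    fix e assume "e \<in> {e. e \<subseteq> rot_classes \<and> card e = 2} \<union>
        (if even m then {} else {e. e \<subseteq> refl_classes \<and> card e = 2})"
    then have e: "card e = 2" "e \<subseteq> rot_classes \<or> odd m \<and> e \<subseteq> refl_classes"
      by (auto split: if_splits)
    then obtain X Y where XY: "e = {X, Y}" "X \<noteq> Y" by (auto simp: card_2_iff)
    then have "X \<in> V" "Y \<in> V" using e(2) unfolding V_def by blast+
    moreover from this have "adj X Y" using adj_iff[of X Y] e(2) XY by blast
    ultimately show "e \<in> edges (CCC G)" unfolding E using XY by blast
  qed
qed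

section \<open>Decomposition into cliques and evaluation of the indices\<close>

definition cliques :: "'a set set set" where
  "cliques = insert rot_classes (if even m then (\<lambda>X. {X}) ` refl_classes else {refl_classes})"

text \<open>For even \<open>m\<close> each class outside \<open>\<langle>a\<rangle>\<close> is a
  clique of its own without edges; for odd \<open>m\<close> the four of them form one
  clique.\<close>

lemma clique_union_CCC: "clique_union (CCC G) cliques"
proof
  show "finite cliques" using finite_refl_classes by (simp add: cliques_def)
  show "finite C" if "C \<in> cliques" for C
    using that finite_rot_classes finite_refl_classes by (auto simp: cliques_def split: if_splits)
  show "C \<inter> D = {}" if "C \<in> cliques" "D \<in> cliques" "C \<noteq> D" for C D
    using that rot_refl_classes_disjoint unfolding cliques_def by (auto split: if_splits)
  show "vertices (CCC G) = \<Union>cliques" unfolding vertices_CCC cliques_def by auto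
  define S where "S C = {e. e \<subseteq> C \<and> card e = 2}" for C :: "'a set set"
  have "S {X} = {}" for X by (auto simp: S_def subset_singleton_iff)
  then show "edges (CCC G) = (\<Union>C\<in>cliques. {e. e \<subseteq> C \<and> card e = 2})"
    unfolding edges_CCC cliques_def S_def[symmetric] by simp
qed

text \<open>Both indices and the numbers of vertices and edges are sums of a function of the clique
  sizes, so one evaluation for arbitrary \<open>f\<close> serves all four.\<close>

lemma sum_cliques:
  fixes f :: "nat \<Rightarrow> nat"
  shows "(\<Sum>C\<in>cliques. f (card C)) =
    (if even m then f (2 * m - 1) + 2 * f 1 else f (2 * m - 2) + f 4)"
proof -
  \<comment> \<open>The sum runs over a set, so the clique of \<open>rot_classes\<close> must differ
    from the other members to be counted separately.\<close>
  have distinct: "R \<noteq> B \<and> R \<notin> (\<lambda>X. {X}) ` B" if "R \<inter> B = {}" "B \<noteq> {}" for R B :: "'a set set"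
    using that by blast
  have "refl_classes \<noteq> {}" by blast
  note distinct[OF rot_refl_classes_disjoint this]
  moreover have "card rot_classes = (if even m then 2 * m - 1 else 2 * m - 2)"
    using card_rot_classes by (simp add: d_def split: if_splits)
  moreover have "(\<Sum>C\<in>(\<lambda>X. {X}) ` refl_classes. f (card C)) = card refl_classes * f 1"
    by (subst sum.reindex) (auto simp: inj_on_def)
  ultimately show ?thesis
    using finite_refl_classes card_refl_classes by (simp add: cliques_def d_def)
qed

end

theorem theorem2p4:
  fixes m :: nat and G :: "('a, 'b) monoid_scheme"
  assumes "m \<ge> 2"
    and "group G"
    and "G \<cong> semidihedral_group m"
  shows "real (zagreb1 (CCC G)) =
           (if even m then (2 * real m - 1) * (2 * real m - 2) ^ 2
            else (2 * real m - 2) * (2 * real m - 3) ^ 2 + 36)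
       \<and> real (zagreb2 (CCC G)) =
           (if even m then (2 * real m - 1) * (2 * real m - 2) ^ 3 / 2
            else (real m - 1) * (2 * real m - 3) ^ 3 + 54)
       \<and> real (zagreb2 (CCC G)) / real (card (edges (CCC G)))
           \<ge> real (zagreb1 (CCC G)) / real (card (vertices (CCC G)))
       \<and> (m = 3 \<longrightarrow>
           real (zagreb2 (CCC G)) / real (card (edges (CCC G)))
           = real (zagreb1 (CCC G)) / real (card (vertices (CCC G))))"
proof -
  obtain nf where "semidihedral G m nf" using semidihedral_of_iso[OF assms] .
  then interpret semidihedral G m nf .
  interpret clique_union "CCC G" cliques by (rule clique_union_CCC)
  have choose: "real (n choose 2) = real n * (real n - 1) / 2" for n
    by (induction n) (auto simp: numeral_2_eq_2 field_simps)
  show ?thesis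
  proof (cases "even m")
    case True
    define x where "x = real m"
    have x: "x \<ge> 2" "real (2 * m - 1) = 2 * x - 1" "real (2 * m - 1 - 1) = 2 * x - 2"
      using assms(1) by (simp_all add: x_def of_nat_diff)
    have M1: "real (zagreb1 (CCC G)) = (2 * x - 1) * (2 * x - 2) ^ 2"
      and M2: "real (zagreb2 (CCC G)) = (2 * x - 1) * (2 * x - 2) ^ 3 / 2"
      and E: "real (card (edges (CCC G))) = (2 * x - 1) * (2 * x - 2) / 2"
      and V: "real (card (vertices (CCC G))) = 2 * x + 1"
      using True x sum_cliques[of "\<lambda>n. n * (n - 1)\<^sup>2"] sum_cliques[of "\<lambda>n. (n choose 2) * (n - 1)\<^sup>2"]
        sum_cliques[of "\<lambda>n. n choose 2"] sum_cliques[of "\<lambda>n. n"]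
      by (simp_all add: zagreb1_eq zagreb2_eq card_edges card_vertices choose
          power2_eq_square power3_eq_cube del: of_nat_diff)
    \<comment> \<open>All edges lie in one clique, so the mean over the edges is the square of its
      common degree.\<close>
    have "(2 * x - 1) * (2 * x - 2) ^ 3 / 2 / ((2 * x - 1) * (2 * x - 2) / 2) = (2 * x - 2) ^ 2"
      using x by (simp add: power2_eq_square power3_eq_cube)
    \<comment> \<open>The two isolated vertices enlarge the denominator from
      \<open>2 * x - 1\<close> to \<open>2 * x + 1\<close> and can only lower the mean over the
      vertices.\<close>
    moreover have "(2 * x - 1) * (2 * x - 2) ^ 2 / (2 * x + 1) \<le> (2 * x - 2) ^ 2"
      using x by (simp add: divide_le_eq mult.commute mult_left_mono)
    ultimately show ?thesis
      using True unfolding M1 M2 E V by (auto simp: x_def)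
  next
    case False
    define x where "x = real m"
    have "m \<ge> 3" using False assms(1) by (cases "m = 2") auto
    then have x: "x \<ge> 3" "real (2 * m - 2) = 2 * x - 2" "real (2 * m - 2 - 1) = 2 * x - 3"
      by (simp_all add: x_def of_nat_diff)
    \<comment> \<open>The constants come from the clique on four vertices:
      \<open>36 = 4 * 3^2\<close>, \<open>54 = 6 * 3^2\<close>, and 6 edges.\<close>
    have M1: "real (zagreb1 (CCC G)) = (2 * x - 2) * (2 * x - 3) ^ 2 + 36"
      and M2: "real (zagreb2 (CCC G)) = (x - 1) * (2 * x - 3) ^ 3 + 54"
      and E: "real (card (edges (CCC G))) = (x - 1) * (2 * x - 3) + 6"
      and V: "real (card (vertices (CCC G))) = 2 * x + 2"
      using False x sum_cliques[of "\<lambda>n. n * (n - 1)\<^sup>2"] sum_cliques[of "\<lambda>n. (n choose 2) * (n - 1)\<^sup>2"]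
        sum_cliques[of "\<lambda>n. n choose 2"] sum_cliques[of "\<lambda>n. n"]
      by (simp_all add: zagreb1_eq zagreb2_eq card_edges card_vertices choose
          power2_eq_square power3_eq_cube del: of_nat_diff) (simp add: algebra_simps)
    \<comment> \<open>The difference of the cross products of the two fractions factors, with
      \<open>(x - 3)^2\<close> showing its sign.\<close>
    have "((x - 1) * (2 * x - 3) ^ 3 + 54) * (2 * x + 2)
        - ((2 * x - 2) * (2 * x - 3) ^ 2 + 36) * ((x - 1) * (2 * x - 3) + 6)
        = 32 * (x - 1) * x * (x - 3) ^ 2"
      by (simp add: power2_eq_square power3_eq_cube algebra_simps)
    moreover have "32 * (x - 1) * x * (x - 3) ^ 2 \<ge> 0" using x by simp
    ultimately have "((2 * x - 2) * (2 * x - 3) ^ 2 + 36) * ((x - 1) * (2 * x - 3) + 6)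
        \<le> ((x - 1) * (2 * x - 3) ^ 3 + 54) * (2 * x + 2)" by linarith
    moreover have "(x - 1) * (2 * x - 3) + 6 > 0" using x by (simp add: add_nonneg_pos)
    moreover have "p / q \<le> r / s" if "p * s \<le> r * q" "s > 0" "q > 0" for p q r s :: real
      using that by (simp add: field_simps)
    ultimately have "((2 * x - 2) * (2 * x - 3) ^ 2 + 36) / (2 * x + 2)
        \<le> ((x - 1) * (2 * x - 3) ^ 3 + 54) / ((x - 1) * (2 * x - 3) + 6)"
      using x by simp
    \<comment> \<open>For \<open>m = 3\<close> both cliques have four vertices, so the graph is
      regular of degree 3 and both quotients equal 9.\<close>
    then show ?thesis
      using False unfolding M1 M2 E V by (auto simp: x_def)
  qed
qed

end
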